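(* For any circulation $X\colon E\to\mathbb Z$ on a directed graph $G=(V,E,c)$, there exists a circulation $Y\colon E\to\mathbb Z$ such that $X\equiv_2 Y$ and $\Vert Y\Vert\le 1$.
   Context: $G=(V,E,c)$ is a directed graph with no sources and no sinks, with a cost function $c\colon E\to\mathbb R_{\ge0}$. A circulation is a function $X$ on $E$ such that at every node the sum of values on incoming edges equals the sum of values on outgoing edges. $\Vert X\Vert=\max_{e\in E}|X(e)|$. $X\equiv_2Y$ means that for every $e\in E$, $X(e)$ is odd if and only if $Y(e)$ is odd. *)

theory Defs
  imports Complex_Main "Graph_Theory.Digraph"
begin

text \<open>
  The graphs are finite; loops and parallel arcs are allowed.
\<close>

locale cost_digraph = fin_digraph G
  for G :: "('v, 'e) pre_digraph" (structure) +
  fixes c :: "'e \<Rightarrow> real"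
  assumes cost_nonneg: "e \<in> arcs G \<Longrightarrow> 0 \<le> c e"
    and no_sources: "v \<in> verts G \<Longrightarrow> in_arcs G v \<noteq> {}"
    and no_sinks: "v \<in> verts G \<Longrightarrow> out_arcs G v \<noteq> {}"

text \<open>
  A function on the arc set is represented by a total function on the type of arcs;
  the following three notions depend only on its values on \<^term>\<open>arcs G\<close>.
\<close>

definition circulation :: "('v, 'e) pre_digraph \<Rightarrow> ('e \<Rightarrow> 'n::comm_monoid_add) \<Rightarrow> bool" where
  "circulation G X \<longleftrightarrow>
    (\<forall>v \<in> verts G. (\<Sum>e\<in>in_arcs G v. X e) = (\<Sum>e\<in>out_arcs G v. X e))"

text \<open>
  The maximum over the arcs is taken to be 0 for the null graph, where \<^const>\<open>Max\<close> of
  the empty set is unspecified.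
\<close>

definition circ_norm :: "('v, 'e) pre_digraph \<Rightarrow> ('e \<Rightarrow> 'n::linordered_idom) \<Rightarrow> 'n" where
  "circ_norm G X = (if arcs G = {} then 0 else Max ((\<lambda>e. \<bar>X e\<bar>) ` arcs G))"

definition parity_eq :: "('v, 'e) pre_digraph \<Rightarrow> ('e \<Rightarrow> int) \<Rightarrow> ('e \<Rightarrow> int) \<Rightarrow> bool" where
  "parity_eq G X Y \<longleftrightarrow> (\<forall>e \<in> arcs G. odd (X e) \<longleftrightarrow> odd (Y e))"

end

theory Submission
  imports Defs
begin

text \<open>
  The odd arcs of a circulation form a subgraph with all degrees even, and it suffices to give it
  an Eulerian orientation: the sign \<open>1\<close> keeps an arc, the sign \<open>-1\<close> reverses it.
  Such an orientation is found by splitting off: if a non-loop \<open>e\<close> ends in \<open>w\<close>,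
  then by parity another arc \<open>f\<close> meets \<open>w\<close>; replace \<open>e\<close> and \<open>f\<close> by a
  single arc following both, orient the smaller graph, and let \<open>e\<close> and \<open>f\<close> inherit
  the direction of the merged arc.
\<close>

lemma eulerian_signing:
  fixes t h :: "'e \<Rightarrow> 'v"
  assumes "finite F"
    and "\<And>v. even (\<Sum>e\<in>F. of_bool (h e = v) - of_bool (t e = v) :: int)"
  shows "\<exists>s :: 'e \<Rightarrow> int. (\<forall>e\<in>F. \<bar>s e\<bar> = 1) \<and>
           (\<forall>v. (\<Sum>e\<in>F. s e * (of_bool (h e = v) - of_bool (t e = v))) = 0)"
  using assms
\<comment> \<open>Merging two arcs changes only the head of \<open>e\<close>, so \<open>h\<close> is
  generalized while \<open>t\<close> stays fixed.\<close>
proof (induction F arbitrary: h rule: finite_psubset_induct)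
  case (psubset F)
  let ?d = "\<lambda>e v. of_bool (h e = v) - of_bool (t e = v) :: int"
  show ?case
  proof (cases "F = {}")
    case False
    then obtain e where e: "e \<in> F" by blast
    have split_e: "sum g F = g e + sum g (F - {e})" for g :: "'e \<Rightarrow> int"
      using e psubset.hyps(1) by (simp add: sum.remove)
    show ?thesis
    proof (cases "h e = t e")
      case True
      have "even (\<Sum>a\<in>F - {e}. ?d a v)" for v
        using psubset.prems[of v] split_e[of "\<lambda>a. ?d a v"] True by simp
      with psubset.IH[of "F - {e}" h] e obtain s :: "'e \<Rightarrow> int" where
        s: "\<forall>a\<in>F - {e}. \<bar>s a\<bar> = 1" "\<And>v. (\<Sum>a\<in>F - {e}. s a * ?d a v) = 0"
        by blast
      \<comment> \<open>A loop contributes 0 at every node, so either sign would do for it.\<close>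
      have "(\<Sum>a\<in>F. (s(e := 1)) a * ?d a v) = 0" for v
      proof -
        have "(\<Sum>a\<in>F - {e}. (s(e := 1)) a * ?d a v) = (\<Sum>a\<in>F - {e}. s a * ?d a v)"
          by (intro sum.cong) auto
        then show ?thesis
          using True s(2)[of v] by (subst split_e) simp
      qed
      with s(1) show ?thesis by (intro exI[of _ "s(e := 1)"]) auto
    next
      case False
      define w where "w = h e"
      \<comment> \<open>The non-loop \<open>e\<close> contributes 1 at its head \<open>w\<close>;
        evenness of the total forces another non-loop at \<open>w\<close>.\<close>
      have "odd (\<Sum>a\<in>F - {e}. ?d a w)"
        using psubset.prems[of w] split_e[of "\<lambda>a. ?d a w"] False by (simp add: w_def)
      then obtain f where f: "f \<in> F" "f \<noteq> e" "?d f w \<noteq> 0"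
        by (metis (mono_tags, lifting) DiffE even_zero insertI1 sum.neutral)
      \<comment> \<open>\<open>u\<close> is the far end of \<open>f\<close>; \<open>\<sigma>\<close>
        is 1 if \<open>f\<close> leaves \<open>w\<close>, and -1 if following \<open>e\<close> and
        then \<open>f\<close> runs against the direction of \<open>f\<close>.\<close>
      define u where "u = (if t f = w then h f else t f)"
      define \<sigma> :: int where "\<sigma> = (if t f = w then 1 else - 1)"
      have df: "?d f v = \<sigma> * (of_bool (u = v) - of_bool (w = v))" for v
        using f(3) by (auto simp: u_def \<sigma>_def split: if_splits)
      \<comment> \<open>The merged arc from \<open>t e\<close> to \<open>u\<close> reuses the name
        \<open>e\<close>, and \<open>f\<close> is dropped.\<close>
      let ?h = "h(e := u)"
      let ?d' = "\<lambda>a v. of_bool (?h a = v) - of_bool (t a = v) :: int"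
      have split_f: "sum g (F - {f}) = g e + sum g (F - {e} - {f})" for g :: "'e \<Rightarrow> int"
        using e f psubset.hyps(1) sum.remove[of "F - {f}" e g]
        by (simp add: Diff_insert [symmetric] insert_commute)
      have split_ef: "sum g F = g e + g f + sum g (F - {e} - {f})" for g :: "'e \<Rightarrow> int"
        using f psubset.hyps(1) sum.remove[of "F - {e}" f g] by (simp add: split_e)
      have "even (\<Sum>a\<in>F - {f}. ?d' a v)" for v
      proof -
        have "(\<Sum>a\<in>F - {e} - {f}. ?d' a v) = (\<Sum>a\<in>F - {e} - {f}. ?d a v)"
          by (intro sum.cong) auto
        then have "(\<Sum>a\<in>F. ?d a v) - (\<Sum>a\<in>F - {f}. ?d' a v)
            = (\<sigma> - 1) * (of_bool (u = v) - of_bool (w = v))"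
          by (simp add: split_ef split_f df w_def algebra_simps)
        moreover have "even (\<sigma> - 1)" by (simp add: \<sigma>_def)
        ultimately have "even ((\<Sum>a\<in>F. ?d a v) - (\<Sum>a\<in>F - {f}. ?d' a v))"
          by (metis dvd_mult2)
        then show ?thesis
          using dvd_diff_right_iff[OF psubset.prems[of v]] by blast
      qed
      with psubset.IH[of "F - {f}" ?h] f(1) obtain s :: "'e \<Rightarrow> int" where
        s: "\<forall>a\<in>F - {f}. \<bar>s a\<bar> = 1" "\<And>v. (\<Sum>a\<in>F - {f}. s a * ?d' a v) = 0"
        by blast
      \<comment> \<open>The factor \<open>\<sigma>\<close> makes \<open>f\<close> continue the walk
        from \<open>w\<close> to \<open>u\<close>, so the contributions of \<open>e\<close> and
        \<open>f\<close> cancel at \<open>w\<close> and add up to that of the merged arc.\<close>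
      let ?s = "s(f := \<sigma> * s e)"
      have "(\<Sum>a\<in>F. ?s a * ?d a v) = 0" for v
      proof -
        have "(\<Sum>a\<in>F - {e} - {f}. ?s a * ?d a v) = (\<Sum>a\<in>F - {e} - {f}. s a * ?d' a v)"
          by (intro sum.cong) auto
        moreover have "\<sigma> * \<sigma> = 1" by (simp add: \<sigma>_def)
        then have "\<sigma> * s e * ?d f v = s e * (of_bool (u = v) - of_bool (w = v))"
          unfolding df by (metis mult.assoc mult.commute mult_1)
        ultimately show ?thesis
          using s(2)[of v] f(2) by (simp add: split_ef split_f w_def algebra_simps)
      qed
      moreover have "\<forall>a\<in>F. \<bar>?s a\<bar> = 1"
        using s(1) e f(2) by (auto simp: \<sigma>_def)
      ultimately show ?thesis by blast
    qed
  qed simp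
qed

text \<open>Loops cancel in the signed sum, and a \<open>v\<close> outside \<open>verts G\<close>
  meets no arc, so balance can be required at every \<open>v\<close>, as in
  \<open>eulerian_signing\<close>.\<close>

lemma (in fin_digraph) circulation_iff_sum_arcs:
  fixes X :: "'b \<Rightarrow> int"
  shows "circulation G X \<longleftrightarrow>
    (\<forall>v. (\<Sum>e\<in>arcs G. X e * (of_bool (head G e = v) - of_bool (tail G e = v))) = 0)"
proof -
  have "(\<Sum>e\<in>arcs G. X e * (of_bool (head G e = v) - of_bool (tail G e = v))) =
      (\<Sum>e\<in>in_arcs G v. X e) - (\<Sum>e\<in>out_arcs G v. X e)" for v
    by (auto simp: in_arcs_def out_arcs_def sum.inter_filter sum_subtractf [symmetric]
        intro!: sum.cong)
  moreover have "in_arcs G v = {}" "out_arcs G v = {}" if "v \<notin> verts G" for v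
    using that by (auto simp: in_arcs_def out_arcs_def)
  ultimately show ?thesis
    unfolding circulation_def by (metis eq_iff_diff_eq_0)
qed

theorem lemma21:
  fixes G :: "('v, 'e) pre_digraph"
    and c :: "'e \<Rightarrow> real"
    and X :: "'e \<Rightarrow> int"
  assumes "cost_digraph G c"
    and "circulation G X"
  shows "\<exists>Y :: 'e \<Rightarrow> int. circulation G Y \<and> parity_eq G X Y \<and> circ_norm G Y \<le> 1"
proof -
  interpret cost_digraph G c by fact
  let ?d = "\<lambda>e v. of_bool (head G e = v) - of_bool (tail G e = v) :: int"
  define F where "F = {e \<in> arcs G. odd (X e)}"
  have F: "finite F" "F \<subseteq> arcs G" by (auto simp: F_def)
  have "even (\<Sum>e\<in>F. ?d e v)" for v
  proof -
    have "(\<Sum>e\<in>F. ?d e v) = (\<Sum>e\<in>arcs G. of_bool (odd (X e)) * ?d e v)"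
      using F by (intro sum.mono_neutral_cong_left) (auto simp: F_def)
    moreover have "(\<Sum>e\<in>arcs G. X e * ?d e v) = 0"
      using assms(2) circulation_iff_sum_arcs by blast
    \<comment> \<open>Subtracting the vanishing sum for \<open>X\<close> leaves coefficients that
      are all even.\<close>
    ultimately have "(\<Sum>e\<in>F. ?d e v) = (\<Sum>e\<in>arcs G. (of_bool (odd (X e)) - X e) * ?d e v)"
      by (simp add: left_diff_distrib sum_subtractf)
    also have "even \<dots>" by (intro dvd_sum dvd_mult2) auto
    finally show ?thesis .
  qed
  then obtain s :: "'e \<Rightarrow> int" where s: "\<forall>e\<in>F. \<bar>s e\<bar> = 1" "\<And>v. (\<Sum>e\<in>F. s e * ?d e v) = 0"
    using eulerian_signing[OF F(1), of "head G" "tail G"] by blast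
  define Y where "Y e = (if e \<in> F then s e else 0)" for e
  have "(\<Sum>e\<in>arcs G. Y e * ?d e v) = (\<Sum>e\<in>F. s e * ?d e v)" for v
    using F by (intro sum.mono_neutral_cong_right) (auto simp: Y_def)
  then have "circulation G Y"
    using s(2) by (simp add: circulation_iff_sum_arcs)
  moreover have "odd (s e)" if "e \<in> F" for e
    using s(1) that by (metis dvd_abs_iff odd_one)
  then have "parity_eq G X Y"
    by (auto simp: parity_eq_def Y_def F_def)
  moreover have "circ_norm G Y \<le> 1"
    using s(1) by (auto simp: circ_norm_def Y_def)
  ultimately show ?thesis by blast
qed

end
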